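(* Let $\mathcal{O}=(V,E)$ be an ontology, i.e., a directed acyclic graph with vertex set $V$ and edge set $E\subset V\times V$, and suppose ontological annotations are generated by a Bayesian network structured according to $\mathcal{O}$, as described in the context. Let $X$ be a non-empty set of all consistent subgraphs generated according to the probability distribution specified by the Bayesian network, and let $p\geq 1$ be a real parameter, with the possibility that $p=\infty$. Define $d^p:X\times X\to\mathbb{R}$ by $$d^p(F,G)=\big(ru(F,G)^p+mi(F,G)^p\big)^{1/p},$$ where $$mi(F,G)=\sum_{v\in F\setminus G}ia(v),\qquad ru(F,G)=\sum_{v\in G\setminus F}ia(v)$$ (for $p=\infty$, $d^p(F,G)$ is the maximum of $ru(F,G)$ and $mi(F,G)$). Then $(X,d^p)$ is a metric space.
   Context: A consistent subgraph of $\mathcal{O}=(V,E)$ is a set $F\subseteq V$ such that if a vertex $v$ belongs to $F$, then all the ancestors of $v$ up to the root(s) of the ontology also belong to $F$. In the Bayesian network each vertex (concept) of the ontology is a binary random variable, and the graph structure specifies the conditional independence relationships. Each conditional probability table stores a single number $P(v\mid\mathrm{Parents}(v))$, the probability that $v$ is part of an annotation given that all of its parents are part of the annotation; if any parent of $v$ is not part of the annotation, then $v$ is guaranteed not to be in it. The marginal probability of a consistent subgraph $F$, where nodes not in $F$ are treated as unknown and marginalized over, is $P(F)=\prod_{v\in F}P(v\mid\mathrm{Parents}(v))$. The information accretion of $v$ is $ia(v)=-\log P(v\mid\mathrm{Parents}(v))$, so that the information content of $F$ is $\log\frac{1}{P(F)}=\sum_{v\in F}ia(v)$. A metric on $X$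 is a function $d:X\times X\to\mathbb{R}$ that is nonnegative, symmetric, satisfies $d(a,b)=0$ if and only if $a=b$, and satisfies the triangle inequality. *)

theory Defs
  imports "HOL-Probability.Probability"
begin

text \<open>An edge \<open>(u, v)\<close> points from the parent \<open>u\<close> to the child \<open>v\<close>.\<close>

definition ontology :: "'v set \<Rightarrow> ('v \<times> 'v) set \<Rightarrow> bool" where
  "ontology V E \<longleftrightarrow> finite V \<and> E \<subseteq> V \<times> V \<and> acyclic E"

definition parents :: "('v \<times> 'v) set \<Rightarrow> 'v \<Rightarrow> 'v set" where
  "parents E v = {u. (u, v) \<in> E}"

definition ancestors :: "('v \<times> 'v) set \<Rightarrow> 'v \<Rightarrow> 'v set" where
  "ancestors E v = {u. (u, v) \<in> E\<^sup>+}"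

definition consistent :: "'v set \<Rightarrow> ('v \<times> 'v) set \<Rightarrow> 'v set \<Rightarrow> bool" where
  "consistent V E F \<longleftrightarrow> F \<subseteq> V \<and> (\<forall>v\<in>F. ancestors E v \<subseteq> F)"

text \<open>
  An annotation is a set of vertices, and the binary random variable attached to \<open>v\<close> is
  membership of \<open>v\<close> in the random annotation.  The number \<open>\<theta> v\<close> is the stored table entry
  \<open>P(v | Parents(v))\<close>.  The full conditional distribution of the variable at \<open>v\<close>, given the
  values of its parents in the annotation \<open>F\<close>, is the following one: \<open>v\<close> is present with
  probability \<open>\<theta> v\<close> if all parents are present, and is absent otherwise.
\<close>

definition table_prob :: "('v \<times> 'v) set \<Rightarrow> ('v \<Rightarrow> real) \<Rightarrow> 'v set \<Rightarrow> 'v \<Rightarrow> real" where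
  "table_prob E \<theta> F v =
     (let q = (if parents E v \<subseteq> F then \<theta> v else 0) in if v \<in> F then q else 1 - q)"

text \<open>
  The law \<open>M\<close> of the random annotation is that of a Bayesian network over \<open>(V, E)\<close>: it is
  the product over all vertices of the conditional probabilities given the parents.
\<close>

definition bayesian_network ::
  "'v set \<Rightarrow> ('v \<times> 'v) set \<Rightarrow> ('v \<Rightarrow> real) \<Rightarrow> 'v set pmf \<Rightarrow> bool" where
  "bayesian_network V E \<theta> M \<longleftrightarrow>
     (\<forall>v\<in>V. 0 \<le> \<theta> v \<and> \<theta> v \<le> 1) \<and> set_pmf M \<subseteq> Pow V \<and>
     (\<forall>F\<subseteq>V. pmf M F = (\<Prod>v\<in>V. table_prob E \<theta> F v))"

text \<open>
  Consistent subgraphs that the network generates, that is, that occur with positive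
  probability as the complete annotation.  If \<open>\<theta> v = 1\<close>, an annotation containing all parents
  of \<open>v\<close> but not \<open>v\<close> is never generated; without this restriction, adding such a \<open>v\<close>
  to an annotation would give a different annotation at distance zero.
\<close>

definition generated_subgraphs ::
  "'v set \<Rightarrow> ('v \<times> 'v) set \<Rightarrow> 'v set pmf \<Rightarrow> 'v set set" where
  "generated_subgraphs V E M = {F. consistent V E F \<and> F \<in> set_pmf M}"

text \<open>
  The parameter \<open>b\<close> is the base of the logarithm.  A vertex with \<open>\<theta> v = 0\<close>, whose
  information accretion is infinite, gets a junk value here, but lies in no generated subgraph.
\<close>

definition ia :: "real \<Rightarrow> ('v \<Rightarrow> real) \<Rightarrow> 'v \<Rightarrow> real" where
  "ia b \<theta> v = - log b (\<theta> v)"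

definition mi :: "real \<Rightarrow> ('v \<Rightarrow> real) \<Rightarrow> 'v set \<Rightarrow> 'v set \<Rightarrow> real" where
  "mi b \<theta> F G = (\<Sum>v\<in>F - G. ia b \<theta> v)"

definition ru :: "real \<Rightarrow> ('v \<Rightarrow> real) \<Rightarrow> 'v set \<Rightarrow> 'v set \<Rightarrow> real" where
  "ru b \<theta> F G = (\<Sum>v\<in>G - F. ia b \<theta> v)"

definition ontology_dist ::
  "real \<Rightarrow> ('v \<Rightarrow> real) \<Rightarrow> ereal \<Rightarrow> 'v set \<Rightarrow> 'v set \<Rightarrow> real" where
  "ontology_dist b \<theta> p F G =
     (if p = \<infinity> then max (ru b \<theta> F G) (mi b \<theta> F G)
      else (ru b \<theta> F G powr real_of_ereal p + mi b \<theta> F G powr real_of_ereal p)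
             powr (1 / real_of_ereal p))"

text \<open>
  The locale \<^locale>\<open>Metric_space\<close> asks for nonnegativity and symmetry on the whole type, so a
  distance given on \<open>X \<times> X\<close> only is extended by zero.
\<close>

definition dist_on :: "'b set \<Rightarrow> ('b \<Rightarrow> 'b \<Rightarrow> real) \<Rightarrow> 'b \<Rightarrow> 'b \<Rightarrow> real" where
  "dist_on X d x y = (if x \<in> X \<and> y \<in> X then d x y else 0)"

text \<open>The product of the tables is a probability distribution, so every table has a network.\<close>

lemma sum_prod_table_prob:
  assumes "finite V" "acyclic E" "E \<subseteq> V \<times> V"
  shows "(\<Sum>F\<in>Pow V. \<Prod>v\<in>V. table_prob E \<theta> F v) = 1"
  using assms
proof (induction "card V" arbitrary: V E)
  case 0
  then show ?case by simp
next
  case (Suc n)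
  have "wf (E\<inverse>)"
    using Suc.prems by (meson finite_SigmaI finite_acyclic_wf_converse finite_subset)
  moreover have "V \<noteq> {}" using Suc.hyps by auto
  ultimately obtain s where s: "s \<in> V" "\<And>y. (s, y) \<in> E \<Longrightarrow> y \<notin> V"
    by (metis converse_iff wfE_min ex_in_conv)
  define W where "W = V - {s}"
  define E' where "E' = E \<inter> W \<times> W"
  have sE: "(s, y) \<notin> E" for y using s Suc.prems by auto
  have V: "V = insert s W" "s \<notin> W" "finite W" using s Suc.prems by (auto simp: W_def)
  have "card W = n" using Suc.hyps V by simp
  moreover have "acyclic E'" using Suc.prems by (auto simp: E'_def intro: acyclic_subset)
  ultimately have IH: "(\<Sum>F\<in>Pow W. \<Prod>v\<in>W. table_prob E' \<theta> F v) = 1"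
    using Suc.hyps(1)[of W E'] V by (auto simp: E'_def)
  have par: "parents E v = parents E' v" if "v \<in> W" for v
    using Suc.prems(3) sE that unfolding parents_def E'_def W_def by blast
  have parW: "parents E v \<subseteq> W" if "v \<in> V" for v
    using Suc.prems(3) sE that unfolding parents_def W_def by blast
  have 1: "table_prob E \<theta> F v = table_prob E' \<theta> F v" if "v \<in> W" for F v
    by (simp add: table_prob_def par[OF that])
  have 2: "table_prob E \<theta> (insert s F) v = table_prob E' \<theta> F v" if "v \<in> W" for F v
  proof -
    have "parents E v \<subseteq> insert s F \<longleftrightarrow> parents E' v \<subseteq> F"
      using par[OF that] parW[of v] that V by auto
    then show ?thesis using that V by (auto simp: table_prob_def)
  qed
  have 3: "table_prob E \<theta> (insert s F) s + table_prob E \<theta> F s = 1" if "F \<subseteq> W" for F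
  proof -
    have "parents E s \<subseteq> insert s F \<longleftrightarrow> parents E s \<subseteq> F"
      using parW[of s] s V by auto
    then show ?thesis using that V by (auto simp: table_prob_def Let_def)
  qed
  have inj: "inj_on (insert s) (Pow W)" using V(2) by (auto simp: inj_on_def)
  have "(\<Sum>F\<in>Pow V. \<Prod>v\<in>V. table_prob E \<theta> F v) =
     (\<Sum>F\<in>Pow W. \<Prod>v\<in>V. table_prob E \<theta> F v) +
     (\<Sum>F\<in>insert s ` Pow W. \<Prod>v\<in>V. table_prob E \<theta> F v)"
    unfolding V(1) Pow_insert using V by (intro sum.union_disjoint) auto
  also have "\<dots> = (\<Sum>F\<in>Pow W. (\<Prod>v\<in>V. table_prob E \<theta> F v) + (\<Prod>v\<in>V. table_prob E \<theta> (insert s F) v))"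
    using inj by (simp add: sum.reindex sum.distrib)
  also have "\<dots> = (\<Sum>F\<in>Pow W. \<Prod>v\<in>W. table_prob E' \<theta> F v)"
  proof (rule sum.cong[OF refl])
    fix F assume "F \<in> Pow W"
    have "(\<Prod>v\<in>V. table_prob E \<theta> F v) + (\<Prod>v\<in>V. table_prob E \<theta> (insert s F) v) =
        (table_prob E \<theta> (insert s F) s + table_prob E \<theta> F s) * (\<Prod>v\<in>W. table_prob E' \<theta> F v)"
    proof -
      have a: "(\<Prod>v\<in>V. table_prob E \<theta> F v) = table_prob E \<theta> F s * (\<Prod>v\<in>W. table_prob E' \<theta> F v)"
        using V by (simp add: 1)
      have b: "(\<Prod>v\<in>V. table_prob E \<theta> (insert s F) v) =
          table_prob E \<theta> (insert s F) s * (\<Prod>v\<in>W. table_prob E' \<theta> F v)"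
        using V by (simp add: 2)
      show ?thesis by (simp only: a b distrib_right add.commute)
    qed
    with 3 \<open>F \<in> Pow W\<close> show "(\<Prod>v\<in>V. table_prob E \<theta> F v) + (\<Prod>v\<in>V. table_prob E \<theta> (insert s F) v) =
        (\<Prod>v\<in>W. table_prob E' \<theta> F v)" by simp
  qed
  finally show ?case using IH by simp
qed

lemma bayesian_network_exists:
  assumes "ontology V E" "\<forall>v\<in>V. 0 \<le> \<theta> v \<and> \<theta> v \<le> 1"
  shows "\<exists>M. bayesian_network V E \<theta> M"
proof -
  have V: "finite V" using assms by (simp add: ontology_def)
  define f where "f F = (if F \<subseteq> V then \<Prod>v\<in>V. table_prob E \<theta> F v else 0)" for F
  have nonneg: "0 \<le> f F" for F
    using assms(2) by (auto simp: f_def table_prob_def Let_def intro!: prod_nonneg)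
  have "(\<integral>\<^sup>+F. ennreal (f F) \<partial>count_space UNIV) = (\<Sum>F\<in>Pow V. ennreal (f F))"
    using V by (intro nn_integral_count_space'[of "Pow V"]) (auto simp: f_def)
  also have "\<dots> = ennreal (\<Sum>F\<in>Pow V. f F)" using nonneg by (simp add: sum_ennreal)
  also have "(\<Sum>F\<in>Pow V. f F) = 1"
    using sum_prod_table_prob[of V E \<theta>] assms(1) by (simp add: f_def ontology_def)
  finally have sum1: "(\<integral>\<^sup>+F. ennreal (f F) \<partial>count_space UNIV) = 1" by simp
  have pmf: "pmf (embed_pmf f) F = f F" for F
    using nonneg sum1 by (rule pmf_embed_pmf)
  have "F \<subseteq> V" if "F \<in> set_pmf (embed_pmf f)" for F
    using that pmf[of F] by (auto simp: set_pmf_iff f_def split: if_splits)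
  then have "bayesian_network V E \<theta> (embed_pmf f)"
    using assms(2) by (auto simp: bayesian_network_def pmf f_def)
  then show ?thesis ..
qed

end

theory Submission
  imports Defs
begin

text \<open>
  Since \<open>F - H \<subseteq> (F - G) \<union> (G - H)\<close> and information accretion is nonnegative on generated
  subgraphs, \<open>ru\<close> and \<open>mi\<close> satisfy the triangle inequality separately, and Minkowski's
  inequality in the plane combines them.  Separation is where positive probability of the
  annotations enters: a minimal vertex \<open>v\<close> of \<open>F - G\<close> has all its parents in \<open>G\<close>, so
  \<open>ia b \<theta> v = 0\<close>, that is \<open>\<theta> v = 1\<close>, would force \<open>v\<close> into \<open>G\<close>.
\<close>

text \<open>\<open>powr_convex\<close> settles positive arguments. If one argument is 0, the claim
  reduces to \<open>s powr r \<le> s\<close> for the weight \<open>s\<close> of the other. The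
  endpoint matters because \<open>ru\<close> and \<open>mi\<close> may vanish.\<close>

lemma convex_on_powr_atLeast_0:
  fixes r :: real
  assumes r: "r \<ge> 1"
  shows "convex_on {0..} (\<lambda>x. x powr r)"
proof (rule convex_onI)
  fix t x y :: real
  assume t: "0 < t" "t < 1" and xy: "x \<in> {0..}" "y \<in> {0..}"
  have le: "s powr r \<le> s" if "0 < s" "s < 1" for s :: real
    using powr_mono'[OF r, of s] that by simp
  consider "x = 0" | "y = 0" | "0 < x" "0 < y" using xy by fastforce
  then show "((1 - t) *\<^sub>R x + t *\<^sub>R y) powr r \<le> (1 - t) * x powr r + t * y powr r"
  proof cases
    case 1
    then show ?thesis using t xy le[of t] by (simp add: powr_mult mult_right_mono)
  next
    case 2
    then show ?thesis using t xy le[of "1 - t"] by (simp add: powr_mult mult_right_mono)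
  next
    case 3
    then show ?thesis using convex_onD[OF powr_convex[OF r], of t x y] t by simp
  qed
qed (rule convex_real_interval)

lemma minkowski_powr_two:
  fixes r x y u v :: real
  assumes "r \<ge> 1" "x \<ge> 0" "y \<ge> 0" "u \<ge> 0" "v \<ge> 0"
  shows "((x + u) powr r + (y + v) powr r) powr (1 / r)
    \<le> (x powr r + y powr r) powr (1 / r) + (u powr r + v powr r) powr (1 / r)"
proof -
  define A where "A = (x powr r + y powr r) powr (1 / r)"
  define B where "B = (u powr r + v powr r) powr (1 / r)"
  have Ar: "A powr r = x powr r + y powr r" and Br: "B powr r = u powr r + v powr r"
    using assms by (simp_all add: A_def B_def powr_powr)
  have AB: "A \<ge> 0" "B \<ge> 0" by (simp_all add: A_def B_def)
  have zero: "s = 0 \<and> t = 0" if "s powr r + t powr r = 0" for s t :: real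
    using that by (simp add: add_nonneg_eq_0_iff)
  consider "A = 0" | "B = 0" | "A > 0" "B > 0" using AB by linarith
  then have "((x + u) powr r + (y + v) powr r) powr (1 / r) \<le> A + B"
  proof cases
    case 1
    then have "x = 0 \<and> y = 0" using Ar zero[of x y] by simp
    then show ?thesis using AB by (simp add: B_def)
  next
    case 2
    then have "u = 0 \<and> v = 0" using Br zero[of u v] by simp
    then show ?thesis using AB by (simp add: A_def)
  next
    case 3
    \<comment> \<open>The weight for which \<open>(1 - l) / A\<close> and \<open>l / B\<close> both
      equal \<open>1 / (A + B)\<close>.\<close>
    define l where "l = B / (A + B)"
    have l: "0 \<le> l" "l \<le> 1" "1 - l = A / (A + B)" using 3 by (auto simp: l_def field_simps)
    have cv: "((s + t) / (A + B)) powr r \<le> (1 - l) * (s powr r / A powr r) + l * (t powr r / B powr r)"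
      if "s \<ge> 0" "t \<ge> 0" for s t
    proof -
      have "(1 - l) * (s / A) + l * (t / B) = (s + t) / (A + B)"
        unfolding l(3) using 3 by (simp add: l_def add_divide_distrib)
      moreover have "((1 - l) * (s / A) + l * (t / B)) powr r
          \<le> (1 - l) * (s / A) powr r + l * (t / B) powr r"
        using convex_onD[OF convex_on_powr_atLeast_0[OF assms(1)], of l "s / A" "t / B"] l that 3 by simp
      ultimately show ?thesis using that 3 by (simp add: powr_divide)
    qed
    have "((x + u) powr r + (y + v) powr r) / (A + B) powr r
        = ((x + u) / (A + B)) powr r + ((y + v) / (A + B)) powr r"
      by (simp add: powr_divide add_divide_distrib[of "(x + u) powr r"])
    also have "\<dots> \<le> (1 - l) * ((x powr r + y powr r) / A powr r)
        + l * ((u powr r + v powr r) / B powr r)"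
      using cv[of x u] cv[of y v] assms by (simp add: add_divide_distrib distrib_left)
    also have "\<dots> = 1" using 3 unfolding Ar[symmetric] Br[symmetric] by simp
    finally have "(x + u) powr r + (y + v) powr r \<le> (A + B) powr r"
      using 3 by (simp add: divide_le_eq_1)
    then have "((x + u) powr r + (y + v) powr r) powr (1 / r) \<le> ((A + B) powr r) powr (1 / r)"
      using assms by (intro powr_mono2) auto
    also have "\<dots> = A + B" using assms AB by (simp add: powr_powr)
    finally show ?thesis .
  qed
  then show ?thesis by (simp add: A_def B_def)
qed

lemma ru_eq_mi_swap: "ru b \<theta> F G = mi b \<theta> G F"
  by (simp add: ru_def mi_def)

lemma mi_nonneg:
  assumes "\<And>v. v \<in> F \<Longrightarrow> 0 \<le> ia b \<theta> v"
  shows "0 \<le> mi b \<theta> F G"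
  using assms by (auto simp: mi_def intro!: sum_nonneg)

text \<open>\<open>F - G\<close> and \<open>G - H\<close> are disjoint, so the sum over their union
  is exactly the right-hand side.\<close>

lemma mi_triangle:
  assumes "finite F" "finite G"
    and "\<And>v. v \<in> F \<union> G \<Longrightarrow> 0 \<le> ia b \<theta> v"
  shows "mi b \<theta> F H \<le> mi b \<theta> F G + mi b \<theta> G H"
proof -
  have "mi b \<theta> F H \<le> sum (ia b \<theta>) ((F - G) \<union> (G - H))"
    unfolding mi_def using assms by (intro sum_mono2) auto
  also have "\<dots> = mi b \<theta> F G + mi b \<theta> G H"
    unfolding mi_def using assms by (intro sum.union_disjoint) auto
  finally show ?thesis .
qed

lemma ontology_dist_nonneg:
  assumes "0 \<le> mi b \<theta> F G"
  shows "0 \<le> ontology_dist b \<theta> p F G"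
  using assms by (auto simp: ontology_dist_def max_def)

lemma ontology_dist_commute: "ontology_dist b \<theta> p F G = ontology_dist b \<theta> p G F"
  by (simp add: ontology_dist_def ru_eq_mi_swap add.commute max.commute)

text \<open>\<open>a powr c = 0\<close> holds exactly when \<open>a = 0\<close>, whatever the
  exponent, so for finite \<open>p\<close> the outer root and the inner powers can be
  stripped.\<close>

lemma ontology_dist_eq_0_iff:
  assumes "0 \<le> mi b \<theta> F G" "0 \<le> mi b \<theta> G F"
  shows "ontology_dist b \<theta> p F G = 0 \<longleftrightarrow> mi b \<theta> F G = 0 \<and> mi b \<theta> G F = 0"
  using assms by (auto simp: ontology_dist_def ru_eq_mi_swap max_def add_nonneg_eq_0_iff)

lemma ontology_dist_triangle:
  assumes "p \<ge> 1" and "finite F" "finite G" "finite H"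
    and ia: "\<And>v. v \<in> F \<union> G \<union> H \<Longrightarrow> 0 \<le> ia b \<theta> v"
  shows "ontology_dist b \<theta> p F H \<le> ontology_dist b \<theta> p F G + ontology_dist b \<theta> p G H"
proof -
  have nn: "0 \<le> mi b \<theta> F H" "0 \<le> mi b \<theta> H F" "0 \<le> mi b \<theta> F G" "0 \<le> mi b \<theta> G F"
    "0 \<le> mi b \<theta> G H" "0 \<le> mi b \<theta> H G"
    using ia by (auto intro!: mi_nonneg)
  have t1: "mi b \<theta> F H \<le> mi b \<theta> F G + mi b \<theta> G H"
    using assms by (intro mi_triangle) auto
  \<comment> \<open>The triangle inequality for \<open>ru\<close>, read as \<open>mi\<close> along
    the reversed path from \<open>H\<close> through \<open>G\<close> to \<open>F\<close>.\<close>
  have t2: "mi b \<theta> H F \<le> mi b \<theta> G F + mi b \<theta> H G"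
    using assms mi_triangle[of H G b \<theta> F] by (auto simp: add.commute)
  show ?thesis
  proof (cases p)
    case (real r)
    then have r: "r \<ge> 1" using assms(1) by simp
    \<comment> \<open>Monotonicity of the norm in each nonnegative coordinate reduces the claim to
      Minkowski.\<close>
    have "ontology_dist b \<theta> p F H
        \<le> ((mi b \<theta> G F + mi b \<theta> H G) powr r + (mi b \<theta> F G + mi b \<theta> G H) powr r) powr (1 / r)"
      unfolding ontology_dist_def ru_eq_mi_swap using real r nn t1 t2
      by (auto intro!: powr_mono2 add_mono)
    also have "\<dots> \<le> ontology_dist b \<theta> p F G + ontology_dist b \<theta> p G H"
      using minkowski_powr_two[OF r nn(4,3,6,5)] real
      by (simp add: ontology_dist_def ru_eq_mi_swap)
    finally show ?thesis .
  next
    case PInf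
    then show ?thesis using t1 t2 by (simp add: ontology_dist_def ru_eq_mi_swap max_def)
  next
    case MInf
    then show ?thesis using assms(1) by simp
  qed
qed

text \<open>The probability of \<open>F\<close> is the product of these factors and is nonzero. A
  vertex inside \<open>F\<close> thus has \<theta> nonzero, and one outside \<open>F\<close> whose
  parents all lie in \<open>F\<close> has \<theta> different from 1.\<close>

lemma generated_subgraph_table_prob_nonzero:
  assumes "ontology V E" "bayesian_network V E \<theta> M" "F \<in> generated_subgraphs V E M" "v \<in> V"
  shows "table_prob E \<theta> F v \<noteq> 0"
proof -
  have "pmf M F \<noteq> 0" "F \<subseteq> V"
    using assms(3) by (auto simp: generated_subgraphs_def set_pmf_iff consistent_def)
  then show ?thesis
    using assms by (auto simp: bayesian_network_def ontology_def)
qed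

lemma generated_subgraph_prob_pos:
  assumes "ontology V E" "bayesian_network V E \<theta> M" "F \<in> generated_subgraphs V E M" "v \<in> F"
  shows "0 < \<theta> v" "\<theta> v \<le> 1"
proof -
  have v: "v \<in> V" using assms(3,4) by (auto simp: generated_subgraphs_def consistent_def)
  have "\<theta> v \<noteq> 0"
    using generated_subgraph_table_prob_nonzero[OF assms(1-3) v] assms(4)
    by (auto simp: table_prob_def Let_def split: if_splits)
  then show "0 < \<theta> v" "\<theta> v \<le> 1"
    using assms(2) v by (auto simp: bayesian_network_def less_le)
qed

lemma ia_nonneg:
  assumes "b > 1" "0 < x v" "x v \<le> 1"
  shows "0 \<le> ia b x v"
  using assms by (simp add: ia_def)

lemma ia_eq_0_iff:
  assumes "b > 1" "0 < x v"
  shows "ia b x v = 0 \<longleftrightarrow> x v = 1"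
  using assms by (auto simp: ia_def log_def)

lemma generated_subset_if_mi_eq_0:
  assumes O: "ontology V E" and N: "bayesian_network V E \<theta> M" and b: "b > 1"
    and F: "F \<in> generated_subgraphs V E M" and G: "G \<in> generated_subgraphs V E M"
    and mi: "mi b \<theta> F G = 0"
  shows "F \<subseteq> G"
proof (rule ccontr)
  assume "\<not> F \<subseteq> G"
  then obtain w where w: "w \<in> F - G" by auto
  have FV: "F \<subseteq> V" and cF: "\<And>v. v \<in> F \<Longrightarrow> ancestors E v \<subseteq> F"
    using F by (auto simp: generated_subgraphs_def consistent_def)
  have "finite V" "finite E" "acyclic E"
    using O by (auto simp: ontology_def intro: finite_subset)
  then have "finite F" "wf E" using FV by (auto intro: finite_subset finite_acyclic_wf)
  \<comment> \<open>A minimal vertex exists because a finite acyclic relation is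
    well-founded.\<close>
  obtain v where v: "v \<in> F - G" "\<And>u. (u, v) \<in> E \<Longrightarrow> u \<notin> F - G"
    using wfE_min[OF \<open>wf E\<close> w] by metis
  \<comment> \<open>Parents are ancestors, hence in \<open>F\<close> by consistency; by minimality
    of \<open>v\<close> none of them lies outside \<open>G\<close>.\<close>
  have "parents E v \<subseteq> G"
    using v cF[of v] by (auto simp: parents_def ancestors_def)
  \<comment> \<open>In \<open>G\<close> the vertex \<open>v\<close> is absent with all parents
    present, so its factor is \<open>1 - \<theta> v\<close>.\<close>
  then have "\<theta> v \<noteq> 1"
    using generated_subgraph_table_prob_nonzero[OF O N G, of v] v FV
    by (auto simp: table_prob_def)
  moreover have "\<theta> u = 1" if "u \<in> F - G" for u
  proof -
    have pos: "0 < \<theta> u" "\<theta> u \<le> 1" if "u \<in> F" for u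
      using generated_subgraph_prob_pos[OF O N F that] by auto
    \<comment> \<open>A vanishing sum of nonnegative terms has only zero terms.\<close>
    have "\<forall>u\<in>F - G. ia b \<theta> u = 0"
      using mi \<open>finite F\<close> pos b unfolding mi_def
      by (subst (asm) sum_nonneg_eq_0_iff) (auto intro!: ia_nonneg)
    then show ?thesis using that pos[of u] ia_eq_0_iff[where b = b and x = \<theta> and v = u] b by simp
  qed
  ultimately show False using v by blast
qed

theorem theorem6p1:
  fixes V :: "'v set" and E :: "('v \<times> 'v) set"
    and \<theta> :: "'v \<Rightarrow> real" and M :: "'v set pmf"
    and X :: "'v set set" and b :: real and p :: ereal
  assumes "ontology V E"
    and "bayesian_network V E \<theta> M"
    and "X = generated_subgraphs V E M"
    and "X \<noteq> {}"
    and "b > 1"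
    and "p \<ge> 1"
  shows "Metric_space X (dist_on X (ontology_dist b \<theta> p))"
proof -
  have ia: "0 \<le> ia b \<theta> v" if "F \<in> X" "v \<in> F" for F v
    using generated_subgraph_prob_pos[OF assms(1,2)] assms(3,5) that by (auto intro!: ia_nonneg)
  have fin: "finite F" if "F \<in> X" for F
    using that assms(1,3)
    by (auto simp: ontology_def generated_subgraphs_def consistent_def intro: finite_subset)
  have mi: "0 \<le> mi b \<theta> F G" if "F \<in> X" for F G
    using ia that by (auto intro: mi_nonneg)
  show ?thesis
  proof
    show "0 \<le> dist_on X (ontology_dist b \<theta> p) F G" for F G
      by (simp add: dist_on_def ontology_dist_nonneg mi)
    show "dist_on X (ontology_dist b \<theta> p) F G = dist_on X (ontology_dist b \<theta> p) G F" for F G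
      by (auto simp: dist_on_def ontology_dist_commute)
    show "dist_on X (ontology_dist b \<theta> p) F G = 0 \<longleftrightarrow> F = G" if "F \<in> X" "G \<in> X" for F G
    proof
      assume "dist_on X (ontology_dist b \<theta> p) F G = 0"
      then have "mi b \<theta> F G = 0" "mi b \<theta> G F = 0"
        using that mi by (auto simp: dist_on_def ontology_dist_eq_0_iff)
      then show "F = G"
        using generated_subset_if_mi_eq_0[OF assms(1,2,5)] that assms(3) by blast
    next
      assume "F = G"
      then show "dist_on X (ontology_dist b \<theta> p) F G = 0"
        by (simp add: dist_on_def ontology_dist_def ru_def mi_def)
    qed
    show "dist_on X (ontology_dist b \<theta> p) F H
        \<le> dist_on X (ontology_dist b \<theta> p) F G + dist_on X (ontology_dist b \<theta> p) G H"
      if "F \<in> X" "G \<in> X" "H \<in> X" for F G H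
      using that ia ontology_dist_triangle[OF assms(6) fin fin fin, of F G H b \<theta>]
      by (auto simp: dist_on_def)
  qed
qed

end
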